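(* Every directed series-parallel graph $G$ is a laminar series-parallel graph.
   Context: All graphs are simple. A directed graph $G$ is a directed $s$-$t$-series-parallel graph ($s$-$t$-DSP) iff it is a single edge $st$, or it arises from the disjoint union of a directed $s_1$-$t_1$-series-parallel graph $G_1$ and a directed $s_2$-$t_2$-series-parallel graph $G_2$ by one of: (P-composition) identify $s_1$ with $s_2$ and $t_1$ with $t_2$, then $s=s_1,t=t_1$; (S-composition) identify $t_1$ with $s_2$, then $s=s_1,t=t_2$. A directed series-parallel graph (DSP) is an $s$-$t$-DSP for some $s,t$. For vertices $u,v$, $P_G(u,v)$ denotes the subgraph of $G$ induced by the edges on directed $u$-$v$-paths; for an edge $e=uv$ write $P_G(e)=P_G(u,v)$. A directed graph $G=(V,E)$ is a laminar series-parallel graph (LSP) iff (P1) for every $(s,t)\in V^2$, $P_G(s,t)$ is either an $s$-$t$-DSP or contains no edges; and (P2) for all edges $e_1,e_2\in E$, $P_G(e_1)\subseteq P_G(e_2)$ or $P_G(e_2)\subseteq P_G(e_1)$ or $E(P_G(e_1))\cap E(P_G(e_2))=\emptyset$. *)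

theory Defs
  imports "Graph_Theory.Graph_Theory"
begin

definition pair_union ::
  "'a pair_pre_digraph \<Rightarrow> 'a pair_pre_digraph \<Rightarrow> 'a pair_pre_digraph" where
  "pair_union G H = \<lparr> pverts = pverts G \<union> pverts H, parcs = parcs G \<union> parcs H \<rparr>"

text \<open>
  Forming a disjoint union and then identifying terminals is expressed on concrete graphs: the
  two operands already share exactly the vertices that are to be identified, and the composition
  is their union. In a parallel composition the arc sets must be disjoint, since otherwise both
  operands would contain the arc from s to t and the composition would not be simple.
\<close>

inductive st_dsp :: "'a \<Rightarrow> 'a \<Rightarrow> 'a pair_pre_digraph \<Rightarrow> bool" where
  edge: "s \<noteq> t \<Longrightarrow> st_dsp s t \<lparr> pverts = {s, t}, parcs = {(s, t)} \<rparr>"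
| parallel: "st_dsp s t G\<^sub>1 \<Longrightarrow> st_dsp s t G\<^sub>2 \<Longrightarrow>
    pverts G\<^sub>1 \<inter> pverts G\<^sub>2 = {s, t} \<Longrightarrow> parcs G\<^sub>1 \<inter> parcs G\<^sub>2 = {} \<Longrightarrow>
    st_dsp s t (pair_union G\<^sub>1 G\<^sub>2)"
| series: "st_dsp s m G\<^sub>1 \<Longrightarrow> st_dsp m t G\<^sub>2 \<Longrightarrow>
    pverts G\<^sub>1 \<inter> pverts G\<^sub>2 = {m} \<Longrightarrow>
    st_dsp s t (pair_union G\<^sub>1 G\<^sub>2)"

definition dsp :: "'a pair_pre_digraph \<Rightarrow> bool" where
  "dsp G \<longleftrightarrow> (\<exists>s t. st_dsp s t G)"

definition path_arcs :: "'a pair_pre_digraph \<Rightarrow> 'a \<Rightarrow> 'a \<Rightarrow> ('a \<times> 'a) set" where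
  "path_arcs G u v = \<Union> {set p |p. pre_digraph.apath (with_proj G) u p v}"

text \<open>The subgraph induced by a set of arcs has just the end points of these arcs as vertices.\<close>

definition path_subgraph :: "'a pair_pre_digraph \<Rightarrow> 'a \<Rightarrow> 'a \<Rightarrow> 'a pair_pre_digraph" where
  "path_subgraph G u v =
    \<lparr> pverts = fst ` path_arcs G u v \<union> snd ` path_arcs G u v, parcs = path_arcs G u v \<rparr>"

definition arc_subgraph :: "'a pair_pre_digraph \<Rightarrow> 'a \<times> 'a \<Rightarrow> 'a pair_pre_digraph" where
  "arc_subgraph G e = path_subgraph G (fst e) (snd e)"

text \<open>The locale \<^locale>\<open>pair_digraph\<close> comprises the finite digraphs without loops and parallel arcs.\<close>

definition lsp :: "'a pair_pre_digraph \<Rightarrow> bool" where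
  "lsp G \<longleftrightarrow> pair_digraph G \<and>
    (\<forall>s \<in> pverts G. \<forall>t \<in> pverts G.
       st_dsp s t (path_subgraph G s t) \<or> parcs (path_subgraph G s t) = {}) \<and>
    (\<forall>e\<^sub>1 \<in> parcs G. \<forall>e\<^sub>2 \<in> parcs G.
       subgraph (with_proj (arc_subgraph G e\<^sub>1)) (with_proj (arc_subgraph G e\<^sub>2)) \<or>
       subgraph (with_proj (arc_subgraph G e\<^sub>2)) (with_proj (arc_subgraph G e\<^sub>1)) \<or>
       parcs (arc_subgraph G e\<^sub>1) \<inter> parcs (arc_subgraph G e\<^sub>2) = {})"

end

theory Submission
  imports Defs
begin

text \<open>
  Series-parallel digraphs are acyclic, so an arc \<open>(x, y)\<close> lies on a path from \<open>u\<close> to \<open>v\<close> iff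
  \<open>x\<close> is reachable from \<open>u\<close> and \<open>v\<close> is reachable from \<open>y\<close>. In this form the path subgraphs of
  a composition split into path subgraphs of the two operands: a parallel composition leaves them
  unchanged unless \<open>(u, v) = (s, t)\<close>, and in a series composition they are either contained in one
  operand or split at the vertex \<open>m\<close>. Such a split never occurs for an arc \<open>(u, v)\<close>, so apart from
  a direct arc \<open>(s, t)\<close>, whose path subgraph is everything, the path subgraph of an arc stays within
  its operand; hence laminarity is inherited from the operands.
\<close>

definition between :: "('a \<times> 'a) set \<Rightarrow> 'a \<Rightarrow> 'a \<Rightarrow> ('a \<times> 'a) set" where
  "between R u v = {(x, y) \<in> R. (u, x) \<in> R\<^sup>* \<and> (y, v) \<in> R\<^sup>*}"

text \<open>With \<open>Field R\<close> as vertex set no vertex is isolated, as in a subgraph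
  induced by arcs, and composing graphs amounts to uniting relations.\<close>

definition arc_graph :: "('a \<times> 'a) set \<Rightarrow> 'a pair_pre_digraph" where
  "arc_graph R = \<lparr> pverts = Field R, parcs = R \<rparr>"

lemma arc_graph_simps [simp]:
  "pverts (arc_graph R) = Field R" "parcs (arc_graph R) = R"
  by (simp_all add: arc_graph_def)

lemma pair_union_simps [simp]:
  "pverts (pair_union G H) = pverts G \<union> pverts H"
  "parcs (pair_union G H) = parcs G \<union> parcs H"
  by (simp_all add: pair_union_def)

lemma pair_union_arc_graph: "pair_union (arc_graph R) (arc_graph S) = arc_graph (R \<union> S)"
  by (simp add: pair_union_def arc_graph_def)

section \<open>Arcs between two vertices\<close>

lemma between_subset: "between R u v \<subseteq> R"
  by (auto simp: between_def)

lemma rtrancl_Field_iff: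
  assumes "(x, y) \<in> R\<^sup>*"
  shows "x \<in> Field R \<longleftrightarrow> y \<in> Field R"
proof (cases "x = y")
  case False
  then have "x \<in> Domain R" "y \<in> Range R"
    using assms by (auto elim: converse_rtranclE rtranclE)
  then show ?thesis by (auto simp: Field_def)
qed simp

lemma between_nonempty:
  assumes "between R u v \<noteq> {}"
  shows "u \<in> Domain R" "v \<in> Range R"
proof -
  obtain x y where "(x, y) \<in> R" "(u, x) \<in> R\<^sup>*" "(y, v) \<in> R\<^sup>*"
    using assms by (auto simp: between_def)
  then show "u \<in> Domain R" "v \<in> Range R"
    by (auto elim: converse_rtranclE rtranclE)
qed

lemma mem_between_self: "e \<in> R \<Longrightarrow> e \<in> between R (fst e) (snd e)"
  by (auto simp: between_def)

lemma between_same_empty: "acyclic R \<Longrightarrow> between R u u = {}"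
  by (auto simp: between_def acyclic_def)
    (meson rtrancl_into_trancl1 rtrancl_trancl_trancl trancl_rtrancl_trancl)

text \<open>No arc of \<open>S\<close> can be followed by an arc of \<open>R\<close>, so a walk that
  has entered \<open>S\<close> never returns to \<open>R\<close>.\<close>

lemma rtrancl_Un_eq:
  assumes "Range S \<inter> Domain R = {}"
  shows "(R \<union> S)\<^sup>* = R\<^sup>* O S\<^sup>*"
proof
  show "(R \<union> S)\<^sup>* \<subseteq> R\<^sup>* O S\<^sup>*"
  proof (rule subrelI)
    fix x y assume "(x, y) \<in> (R \<union> S)\<^sup>*"
    then show "(x, y) \<in> R\<^sup>* O S\<^sup>*"
    proof (induction rule: rtrancl_induct)
      case base
      show ?case by auto
    next
      case (step y z)
      then obtain w where w: "(x, w) \<in> R\<^sup>*" "(w, y) \<in> S\<^sup>*" by auto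
      show ?case
      proof (cases "(y, z) \<in> S")
        case True
        then show ?thesis using w by (meson relcompI rtrancl_into_rtrancl)
      next
        case False
        then have yz: "(y, z) \<in> R" using step by auto
        \<comment> \<open>The \<open>S\<close>-part of the walk is trivial: its last arc would end
          in \<open>y\<close>, where an \<open>R\<close>-arc starts.\<close>
        then have "w = y" using w(2) assms by (auto elim: rtranclE)
        then show ?thesis using w(1) yz by (meson relcompI rtrancl_into_rtrancl rtrancl.rtrancl_refl)
      qed
    qed
  qed
  show "R\<^sup>* O S\<^sup>* \<subseteq> (R \<union> S)\<^sup>*"
    by (auto intro: rtrancl_trans rtrancl_mono[THEN subsetD, of R] rtrancl_mono[THEN subsetD, of S])
qed

lemma rtrancl_Un_from:
  assumes "Range S \<inter> Domain R = {}" "x \<in> Domain R"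
  shows "(u, x) \<in> (R \<union> S)\<^sup>* \<longleftrightarrow> (u, x) \<in> R\<^sup>*"
proof -
  \<comment> \<open>No \<open>S\<close>-arc enters \<open>x\<close>. Since
    \<open>Not_Domain_rtrancl\<close> speaks of starting points, it is applied to the converse of
    \<open>S\<close>.\<close>
  have "(w, x) \<in> S\<^sup>* \<longleftrightarrow> w = x" for w
    using assms(2) Not_Domain_rtrancl[of x "S\<inverse>" w] assms(1)
    by (auto simp: rtrancl_converse)
  then show ?thesis by (auto simp: rtrancl_Un_eq[OF assms(1)])
qed

lemma rtrancl_Un_to:
  assumes "Range S \<inter> Domain R = {}" "y \<in> Range S"
  shows "(y, v) \<in> (R \<union> S)\<^sup>* \<longleftrightarrow> (y, v) \<in> S\<^sup>*"
proof -
  have "(y, w) \<in> R\<^sup>* \<longleftrightarrow> w = y" for w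
    using assms Not_Domain_rtrancl[of y R w] by auto
  then show ?thesis by (auto simp: rtrancl_Un_eq[OF assms(1)])
qed

text \<open>No walk can switch between the two relations in either direction, so every walk through
  an arc stays in the relation of that arc.\<close>

lemma between_parallel:
  assumes RS: "Range R \<inter> Domain S = {}" and SR: "Range S \<inter> Domain R = {}"
  shows "between (R \<union> S) u v = between R u v \<union> between S u v"
proof -
  have "(u, x) \<in> (R \<union> S)\<^sup>* \<longleftrightarrow> (u, x) \<in> R\<^sup>*" "(y, v) \<in> (R \<union> S)\<^sup>* \<longleftrightarrow> (y, v) \<in> R\<^sup>*"
    if "(x, y) \<in> R" for x y
    using rtrancl_Un_from[OF SR, of x u] rtrancl_Un_to[OF RS, of y v] that
    by (auto simp: Un_commute)
  moreover have "(u, x) \<in> (R \<union> S)\<^sup>* \<longleftrightarrow> (u, x) \<in> S\<^sup>*" "(y, v) \<in> (R \<union> S)\<^sup>* \<longleftrightarrow> (y, v) \<in> S\<^sup>*"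
    if "(x, y) \<in> S" for x y
    using rtrancl_Un_from[OF RS, of x u] rtrancl_Un_to[OF SR, of y v] that
    by (auto simp: Un_commute)
  ultimately show ?thesis by (auto simp: between_def)
qed

text \<open>Walks cross from \<open>R\<close> to \<open>S\<close> only at \<open>m\<close>, which
  all of \<open>R\<close> reaches and from which all of \<open>S\<close> is reached. So for arcs of
  \<open>R\<close> a target in \<open>S\<close> is as good as \<open>m\<close>, and for arcs of
  \<open>S\<close> a source in \<open>R\<close> is as good as \<open>m\<close>.\<close>

lemma between_series:
  assumes m: "Field R \<inter> Field S = {m}" "m \<notin> Domain R" "m \<notin> Range S"
    and to_m: "\<And>x. x \<in> Field R \<Longrightarrow> (x, m) \<in> R\<^sup>*"
    and from_m: "\<And>x. x \<in> Field S \<Longrightarrow> (m, x) \<in> S\<^sup>*"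
  shows "between (R \<union> S) u v =
    between R u (if v \<in> Field S then m else v) \<union> between S (if u \<in> Field R then m else u) v"
proof -
  have SR: "Range S \<inter> Domain R = {}" using m by (auto simp: Field_def)
  have "(u, x) \<in> (R \<union> S)\<^sup>* \<longleftrightarrow> (u, x) \<in> R\<^sup>*" if "(x, y) \<in> R" for x y
    using rtrancl_Un_from[OF SR, of x u] that by auto
  moreover have "(y, v) \<in> (R \<union> S)\<^sup>* \<longleftrightarrow> (y, v) \<in> S\<^sup>*" if "(x, y) \<in> S" for x y
    using rtrancl_Un_to[OF SR, of y v] that by auto
  moreover have "(y, v) \<in> (R \<union> S)\<^sup>* \<longleftrightarrow> (y, if v \<in> Field S then m else v) \<in> R\<^sup>*"
    if "(x, y) \<in> R" for x y
  proof (cases "v \<in> Field S")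
    case True
    have "y \<in> Field R" using that by (auto simp: Field_def)
    then show ?thesis using True to_m from_m by (auto simp: rtrancl_Un_eq[OF SR])
  next
    case False
    then have "(w, v) \<in> S\<^sup>* \<longleftrightarrow> w = v" for w by (auto simp: Field_def elim: rtranclE)
    then show ?thesis using False by (auto simp: rtrancl_Un_eq[OF SR])
  qed
  moreover have "(u, x) \<in> (R \<union> S)\<^sup>* \<longleftrightarrow> (if u \<in> Field R then m else u, x) \<in> S\<^sup>*"
    if "(x, y) \<in> S" for x y
  proof (cases "u \<in> Field R")
    case True
    have "x \<in> Field S" using that by (auto simp: Field_def)
    then show ?thesis using True to_m from_m by (auto simp: rtrancl_Un_eq[OF SR])
  next
    case False
    then have "(u, w) \<in> R\<^sup>* \<longleftrightarrow> w = u" for w by (auto simp: Field_def elim: converse_rtranclE)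
    then show ?thesis using False by (auto simp: rtrancl_Un_eq[OF SR])
  qed
  ultimately show ?thesis by (auto simp: between_def)
qed

section \<open>Paths in acyclic digraphs\<close>

lemma cas_append:
  "pre_digraph.cas H u p v \<Longrightarrow> pre_digraph.cas H v q w \<Longrightarrow> pre_digraph.cas H u (p @ q) w"
  by (induction p arbitrary: u) (auto simp: pre_digraph.cas.simps)

lemma rtrancl_imp_cas:
  assumes "(u, v) \<in> (parcs G)\<^sup>*"
  shows "\<exists>p. set p \<subseteq> parcs G \<and> pre_digraph.cas (with_proj G) u p v"
  using assms
proof (induction rule: converse_rtrancl_induct)
  case base
  show ?case by (rule exI[of _ "[]"]) (simp add: pre_digraph.cas.simps)
next
  case (step x y)
  then obtain p where "set p \<subseteq> parcs G" "pre_digraph.cas (with_proj G) y p v" by auto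
  then show ?case
    using step by (intro exI[of _ "(x, y) # p"]) (simp add: pre_digraph.cas.simps)
qed

lemma cas_reachable:
  assumes "pre_digraph.cas (with_proj G) u p v" "set p \<subseteq> parcs G"
  shows "(u, v) \<in> (parcs G)\<^sup>*"
    and "w \<in> set (pre_digraph.awalk_verts (with_proj G) u p) \<Longrightarrow> (u, w) \<in> (parcs G)\<^sup>*"
    and "(x, y) \<in> set p \<Longrightarrow> (u, x) \<in> (parcs G)\<^sup>* \<and> (y, v) \<in> (parcs G)\<^sup>*"
  using assms
  by (induction p arbitrary: u)
    (auto simp: pre_digraph.cas.simps pre_digraph.awalk_verts.simps
      intro: converse_rtrancl_into_rtrancl)

text \<open>A walk that comes back to its first vertex would close a cycle; the rest is induction on
  the walk.\<close>

lemma distinct_awalk_verts: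
  assumes "acyclic (parcs G)" "pre_digraph.cas (with_proj G) u p v" "set p \<subseteq> parcs G"
  shows "distinct (pre_digraph.awalk_verts (with_proj G) u p)"
  using assms(2,3)
proof (induction p arbitrary: u)
  case (Cons e p)
  then have e: "e \<in> parcs G" "fst e = u" "pre_digraph.cas (with_proj G) (snd e) p v"
    "set p \<subseteq> parcs G"
    by (auto simp: pre_digraph.cas.simps)
  have "u \<notin> set (pre_digraph.awalk_verts (with_proj G) (snd e) p)"
  proof
    assume "u \<in> set (pre_digraph.awalk_verts (with_proj G) (snd e) p)"
    then have "(snd e, u) \<in> (parcs G)\<^sup>*" using e cas_reachable(2) by metis
    moreover have "(u, snd e) \<in> parcs G" using e by (metis prod.collapse)
    ultimately show False using assms(1) by (meson acyclic_def rtrancl_into_trancl2)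
  qed
  then show ?case using Cons e by (auto simp: pre_digraph.awalk_verts.simps)
qed (simp add: pre_digraph.awalk_verts.simps)

text \<open>Reachability only provides walks to and from the arc. Joined together they might repeat
  vertices, which acyclicity excludes.\<close>

lemma path_arcs_eq_between:
  assumes "acyclic (parcs G)" "Field (parcs G) \<subseteq> pverts G"
  shows "path_arcs G u v = between (parcs G) u v"
proof (intro set_eqI iffI)
  fix e assume "e \<in> path_arcs G u v"
  then show "e \<in> between (parcs G) u v"
    using cas_reachable(3)
    by (cases e) (fastforce simp: path_arcs_def between_def pre_digraph.apath_def pre_digraph.awalk_def)
next
  fix e assume e: "e \<in> between (parcs G) u v"
  obtain x y where xy: "e = (x, y)" by force
  have arc: "(x, y) \<in> parcs G" and reach: "(u, x) \<in> (parcs G)\<^sup>*" "(y, v) \<in> (parcs G)\<^sup>*"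
    using e xy by (auto simp: between_def)
  obtain p q where p: "set p \<subseteq> parcs G" "pre_digraph.cas (with_proj G) u p x"
    and q: "set q \<subseteq> parcs G" "pre_digraph.cas (with_proj G) y q v"
    using reach[THEN rtrancl_imp_cas] by auto
  let ?w = "p @ (x, y) # q"
  have w: "set ?w \<subseteq> parcs G" "pre_digraph.cas (with_proj G) u ?w v"
    using p q arc by (auto intro!: cas_append simp: pre_digraph.cas.simps)
  \<comment> \<open>A walk must also start at a vertex of \<open>G\<close>; reaching the arc
    guarantees this for \<open>u\<close>.\<close>
  have "u \<in> Field (parcs G)"
    using rtrancl_Field_iff[OF reach(1)] arc by (auto simp: Field_def)
  then have "pre_digraph.apath (with_proj G) u ?w v"
    using w assms distinct_awalk_verts[OF assms(1) w(2,1)]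
    by (auto simp: pre_digraph.apath_def pre_digraph.awalk_def)
  then show "e \<in> path_arcs G u v"
    unfolding path_arcs_def xy by fastforce
qed

section \<open>Series-parallel digraphs\<close>

lemma wf_source:
  assumes "wf R" "\<And>x. x \<in> Field R \<Longrightarrow> (s, x) \<in> R\<^sup>*"
  shows "s \<notin> Range R"
proof
  assume "s \<in> Range R"
  then obtain x where "(x, s) \<in> R" "(s, x) \<in> R\<^sup>*"
    using assms(2) by (auto simp: Field_def)
  then show False
    using wf_acyclic[OF assms(1)] by (meson acyclic_def rtrancl_into_trancl1)
qed

lemma wf_sink:
  assumes "wf R" "\<And>x. x \<in> Field R \<Longrightarrow> (x, t) \<in> R\<^sup>*"
  shows "t \<notin> Domain R"
proof
  assume "t \<in> Domain R"
  then obtain x where "(t, x) \<in> R" "(x, t) \<in> R\<^sup>*"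
    using assms(2) by (auto simp: Field_def)
  then show False
    using wf_acyclic[OF assms(1)] by (meson acyclic_def rtrancl_into_trancl2)
qed

text \<open>The invariant of series-parallel arc sets that the compositions preserve. Acyclicity is
  recorded as \<open>wf\<close>, because \<open>wf_Un\<close> carries it over to unions.\<close>

definition spans :: "('a \<times> 'a) set \<Rightarrow> 'a \<Rightarrow> 'a \<Rightarrow> bool" where
  "spans R s t \<longleftrightarrow> finite R \<and> wf R \<and> s \<in> Field R \<and> t \<in> Field R \<and>
    (\<forall>x \<in> Field R. (s, x) \<in> R\<^sup>* \<and> (x, t) \<in> R\<^sup>*)"

lemma spans_source: "spans R s t \<Longrightarrow> s \<notin> Range R"
  unfolding spans_def using wf_source by metis

lemma spans_sink: "spans R s t \<Longrightarrow> t \<notin> Domain R"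
  unfolding spans_def using wf_sink by metis

lemma spans_parallel:
  assumes R: "spans R s t" and S: "spans S s t" and "Field R \<inter> Field S = {s, t}"
  shows "spans (R \<union> S) s t"
proof -
  \<comment> \<open>A common element would be \<open>s\<close> or \<open>t\<close>, but no
    \<open>S\<close>-arc enters \<open>s\<close> and no \<open>R\<close>-arc leaves
    \<open>t\<close>.\<close>
  have "Domain R \<inter> Range S = {}"
    using assms(3) spans_sink[OF R] spans_source[OF S] by (auto simp: Field_def)
  then have "wf (R \<union> S)"
    using R S by (auto simp: spans_def intro: wf_Un)
  then show ?thesis
    using R S rtrancl_mono[of R "R \<union> S"] rtrancl_mono[of S "R \<union> S"]
    by (auto simp: spans_def)
qed

lemma spans_series:
  assumes R: "spans R s m" and S: "spans S m t" and "Field R \<inter> Field S = {m}"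
  shows "spans (R \<union> S) s t"
proof -
  have "Domain R \<inter> Range S = {}"
    using assms(3) spans_sink[OF R] by (auto simp: Field_def)
  then have "wf (R \<union> S)"
    using R S by (auto simp: spans_def intro: wf_Un)
  moreover have "(s, x) \<in> (R \<union> S)\<^sup>* \<and> (x, t) \<in> (R \<union> S)\<^sup>*" if "x \<in> Field R \<union> Field S" for x
  proof -
    have "R\<^sup>* \<subseteq> (R \<union> S)\<^sup>*" "S\<^sup>* \<subseteq> (R \<union> S)\<^sup>*" by (simp_all add: rtrancl_mono)
    moreover have "(s, m) \<in> R\<^sup>*" "(m, t) \<in> S\<^sup>*" using R S by (auto simp: spans_def)
    ultimately show ?thesis
      using that R S unfolding spans_def by (meson UnE rtrancl_trans subsetD)
  qed
  ultimately show ?thesis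
    using R S by (auto simp: spans_def)
qed

text \<open>This turns the conditions on \<open>pverts\<close> in the compositions into conditions
  on \<open>Field\<close>, so that the further arguments can work with arc relations alone.\<close>

lemma st_dsp_spans:
  assumes "st_dsp s t G"
  shows "pverts G = Field (parcs G)" "spans (parcs G) s t"
proof -
  have "pverts G = Field (parcs G) \<and> spans (parcs G) s t"
    using assms
  proof induction
    case (edge s t)
    have "wf {(s, t)}" using edge by (auto intro!: finite_acyclic_wf simp: acyclic_def trancl_insert)
    then show ?case by (auto simp: spans_def)
  next
    case (parallel s t G\<^sub>1 G\<^sub>2)
    then show ?case using spans_parallel[of "parcs G\<^sub>1" s t "parcs G\<^sub>2"] by simp
  next
    case (series s m G\<^sub>1 t G\<^sub>2)
    then show ?case using spans_series[of "parcs G\<^sub>1" s m "parcs G\<^sub>2" t] by simp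
  qed
  then show "pverts G = Field (parcs G)" "spans (parcs G) s t" by auto
qed

lemma arc_graph_parcs: "st_dsp s t G \<Longrightarrow> arc_graph (parcs G) = G"
  using st_dsp_spans(1)[of s t G] by (simp add: arc_graph_def)

section \<open>Path subgraphs of compositions: properties (P1) and (P2)\<close>

lemma spans_between: "spans R s t \<Longrightarrow> between R s t = R"
  by (auto simp: spans_def between_def Field_def)

text \<open>If both operands contribute, then \<open>u\<close> starts arcs in both and
  \<open>v\<close> ends arcs in both. The shared vertices are only \<open>s\<close> and
  \<open>t\<close>, which forces \<open>u = s\<close> and \<open>v = t\<close>.\<close>

lemma between_parallel_spans:
  assumes R: "spans R s t" and S: "spans S s t" and meet: "Field R \<inter> Field S = {s, t}"
  shows "between (R \<union> S) u v = between R u v \<union> between S u v"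
    and "(u, v) \<noteq> (s, t) \<Longrightarrow> between R u v = {} \<or> between S u v = {}"
proof -
  have ends: "s \<notin> Range R" "s \<notin> Range S" "t \<notin> Domain R" "t \<notin> Domain S"
    using spans_source spans_sink R S by metis+
  show "between (R \<union> S) u v = between R u v \<union> between S u v"
    using ends meet by (intro between_parallel) (auto simp: Field_def)
  show "between R u v = {} \<or> between S u v = {}" if "(u, v) \<noteq> (s, t)"
  proof (rule ccontr)
    assume "\<not> ?thesis"
    then have "u \<in> Domain R \<inter> Domain S" "v \<in> Range R \<inter> Range S"
      using between_nonempty by (metis IntI)+
    then show False using ends meet that by (auto simp: Field_def)
  qed
qed

lemma between_series_spans:
  assumes R: "spans R s m" and S: "spans S m t" and meet: "Field R \<inter> Field S = {m}"
  shows "between (R \<union> S) u v =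
    between R u (if v \<in> Field S then m else v) \<union> between S (if u \<in> Field R then m else u) v"
  using spans_sink[OF R] spans_source[OF S] R S meet
  by (intro between_series) (auto simp: spans_def)

text \<open>Property (P1), by induction on the construction. The vertices \<open>u\<close> and
  \<open>v\<close> stay arbitrary because a series composition needs the induction hypotheses with
  \<open>m\<close> as an end.\<close>

lemma st_dsp_between:
  assumes "st_dsp s t G"
  shows "st_dsp u v (arc_graph (between (parcs G) u v)) \<or> between (parcs G) u v = {}"
  using assms
proof (induction arbitrary: u v)
  case (edge s t)
  let ?G = "\<lparr>pverts = {s, t}, parcs = {(s, t)}\<rparr>"
  have G: "st_dsp s t ?G" using edge by (rule st_dsp.edge)
  show ?case
  proof (cases "between (parcs ?G) u v = {}")
    case False
    then have "u = s" "v = t" using between_nonempty by fastforce+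
    then show ?thesis
      using G spans_between[OF st_dsp_spans(2)[OF G]] arc_graph_parcs[OF G]
      by (metis (full_types))
  qed simp
next
  case (parallel s t G\<^sub>1 G\<^sub>2)
  let ?R = "parcs G\<^sub>1" and ?S = "parcs G\<^sub>2" and ?G = "pair_union G\<^sub>1 G\<^sub>2"
  have G: "st_dsp s t ?G" using parallel by (intro st_dsp.parallel)
  note spans = st_dsp_spans(2)[OF parallel.hyps(1)] st_dsp_spans(2)[OF parallel.hyps(2)]
  have meet: "Field ?R \<inter> Field ?S = {s, t}"
    using parallel.hyps st_dsp_spans(1) by metis
  show ?case
  proof (cases "(u, v) = (s, t)")
    case True
    then show ?thesis
      using G spans_between[OF st_dsp_spans(2)[OF G]] arc_graph_parcs[OF G] by simp
  next
    case False
    then show ?thesis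
      using between_parallel_spans[OF spans meet, of u v] parallel.IH[of u v] by auto
  qed
next
  case (series s m G\<^sub>1 t G\<^sub>2)
  let ?R = "parcs G\<^sub>1" and ?S = "parcs G\<^sub>2"
  note spans = st_dsp_spans(2)[OF series.hyps(1)] st_dsp_spans(2)[OF series.hyps(2)]
  have meet: "Field ?R \<inter> Field ?S = {m}"
    using series.hyps st_dsp_spans(1) by metis
  have eq: "between (?R \<union> ?S) u v =
      between ?R u (if v \<in> Field ?S then m else v) \<union> between ?S (if u \<in> Field ?R then m else u) v"
    by (rule between_series_spans[OF spans meet])
  have R_empty: "between ?R u w = {}" if "u \<notin> Field ?R" for w
    using that between_nonempty(1)[of ?R u w] by (auto simp: Field_def)
  have S_empty: "between ?S w v = {}" if "v \<notin> Field ?S" for w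
    using that between_nonempty(2)[of ?S w v] by (auto simp: Field_def)
  \<comment> \<open>In the first four cases one operand contributes nothing. In the last one the
    paths cross \<open>m\<close>, and the result is itself a series composition.\<close>
  consider "u \<notin> Field ?R" | "v \<notin> Field ?S" | "u = m" | "v = m"
    | "u \<in> Field ?R" "v \<in> Field ?S" "u \<noteq> m" "v \<noteq> m" by blast
  then show ?case
  proof cases
    case 1
    then show ?thesis using eq R_empty series.IH(2)[of u v] by simp
  next
    case 2
    then show ?thesis using eq S_empty series.IH(1)[of u v] by simp
  next
    case 3
    then have "between ?R u w = {}" for w
      using between_nonempty(1) spans_sink[OF spans(1)] by metis
    then show ?thesis using 3 eq series.IH(2)[of u v] by simp
  next
    case 4
    then have "between ?S w v = {}" for w
      using between_nonempty(2) spans_source[OF spans(2)] by metis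
    then show ?thesis using 4 eq meet series.IH(1)[of u v] by (auto split: if_splits)
  next
    case 5
    let ?A = "between ?R u m" and ?B = "between ?S m v"
    have "(u, m) \<in> ?R\<^sup>*" "(m, v) \<in> ?S\<^sup>*"
      using 5 spans by (auto simp: spans_def)
    \<comment> \<open>As \<open>u\<close> and \<open>v\<close> differ from \<open>m\<close>, the
      walk from \<open>u\<close> to \<open>m\<close> has a first arc and the walk from
      \<open>m\<close> to \<open>v\<close> has a last one.\<close>
    then have "?A \<noteq> {}" "?B \<noteq> {}"
      using 5(3,4) by (auto simp: between_def elim!: converse_rtranclE[of u] rtranclE[of m v])
    then have A: "st_dsp u m (arc_graph ?A)" and B: "st_dsp m v (arc_graph ?B)"
      using series.IH by blast+
    have "Field ?A \<inter> Field ?B \<subseteq> {m}"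
      using meet mono_Field[OF between_subset, of ?R] mono_Field[OF between_subset, of ?S] by blast
    \<comment> \<open>By the induction hypotheses \<open>m\<close> is a terminal of both pieces,
      hence a vertex of both.\<close>
    moreover have "m \<in> Field ?A" "m \<in> Field ?B"
      using st_dsp_spans(2)[OF A] st_dsp_spans(2)[OF B] by (auto simp: spans_def)
    ultimately have "Field ?A \<inter> Field ?B = {m}" by blast
    then have "st_dsp u v (arc_graph (?A \<union> ?B))"
      using st_dsp.series[OF A B] by (simp add: pair_union_arc_graph)
    then show ?thesis using eq 5 by simp
  qed
qed

text \<open>Property (P2) for arc sets. Two arcs of the same operand are compared by the induction
  hypothesis; arcs of different operands have disjoint sets, unless one of them is the direct arc of
  a parallel composition.\<close>

lemma st_dsp_laminar:
  assumes "st_dsp s t G" "e \<in> parcs G" "f \<in> parcs G"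
  defines "I \<equiv> \<lambda>g. between (parcs G) (fst g) (snd g)"
  shows "I e \<subseteq> I f \<or> I f \<subseteq> I e \<or> I e \<inter> I f = {}"
  using assms(1-3) unfolding I_def
proof (induction arbitrary: e f)
  case (edge s t)
  then show ?case by simp
next
  case (parallel s t G\<^sub>1 G\<^sub>2)
  let ?R = "parcs G\<^sub>1" and ?S = "parcs G\<^sub>2"
  note spans = st_dsp_spans(2)[OF parallel.hyps(1)] st_dsp_spans(2)[OF parallel.hyps(2)]
  have meet: "Field ?R \<inter> Field ?S = {s, t}"
    using parallel.hyps st_dsp_spans(1) by metis
  note split = between_parallel_spans[OF spans meet]
  have full: "between (?R \<union> ?S) s t = ?R \<union> ?S"
    by (rule spans_between[OF spans_parallel[OF spans meet]])
  \<comment> \<open>The \<open>?R\<close>-part contains \<open>g\<close> itself, so the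
    \<open>?S\<close>-part must be the empty one.\<close>
  have R: "between (?R \<union> ?S) (fst g) (snd g) = between ?R (fst g) (snd g)"
    if "g \<in> ?R" "g \<noteq> (s, t)" for g
    using that split[of "fst g" "snd g"] mem_between_self[of g ?R] by (cases g) auto
  have S: "between (?R \<union> ?S) (fst g) (snd g) = between ?S (fst g) (snd g)"
    if "g \<in> ?S" "g \<noteq> (s, t)" for g
    using that split[of "fst g" "snd g"] mem_between_self[of g ?S] by (cases g) auto
  consider "e = (s, t)" | "f = (s, t)" | "e \<noteq> (s, t)" "f \<noteq> (s, t)" by blast
  then show ?case
  proof cases
    case 1
    then show ?thesis using full between_subset[of "?R \<union> ?S" "fst f" "snd f"] by simp
  next
    case 2
    then show ?thesis using full between_subset[of "?R \<union> ?S" "fst e" "snd e"] by simp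
  next
    case 3
    have disjoint: "between ?R a b \<inter> between ?S c d = {}" for a b c d
      using parallel.hyps(4) between_subset[of ?R a b] between_subset[of ?S c d] by blast
    have "e \<in> ?R \<or> e \<in> ?S" "f \<in> ?R \<or> f \<in> ?S" using parallel.prems by auto
    then show ?thesis
      using 3 R S parallel.IH disjoint by (elim disjE) (simp_all add: Int_commute)
  qed
next
  case (series s m G\<^sub>1 t G\<^sub>2)
  let ?R = "parcs G\<^sub>1" and ?S = "parcs G\<^sub>2"
  note spans = st_dsp_spans(2)[OF series.hyps(1)] st_dsp_spans(2)[OF series.hyps(2)]
  have meet: "Field ?R \<inter> Field ?S = {m}"
    using series.hyps st_dsp_spans(1) by metis
  have m: "m \<notin> Domain ?R" "m \<notin> Range ?S"
    using spans_sink[OF spans(1)] spans_source[OF spans(2)] by auto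
  have acyclic: "acyclic ?R" "acyclic ?S"
    using spans by (auto simp: spans_def wf_acyclic)
  have R: "between (?R \<union> ?S) (fst g) (snd g) = between ?R (fst g) (snd g)" if "g \<in> ?R" for g
  proof -
    have Field: "fst g \<in> Field ?R" "snd g \<in> Field ?R"
      using that by (cases g; auto simp: Field_def)+
    then have "snd g \<in> Field ?S \<Longrightarrow> snd g = m" using meet by blast
    \<comment> \<open>Either the head of \<open>g\<close> is \<open>m\<close>, and a non-empty set
      would give a cycle through \<open>m\<close>, or the head lies outside \<open>?S\<close> and no
      \<open>?S\<close>-arc leads to it.\<close>
    moreover from this have "between ?S m (snd g) = {}"
      using between_same_empty[OF acyclic(2)] between_nonempty(2)[of ?S m "snd g"]
      by (metis FieldI2 DomainE RangeE)
    ultimately show ?thesis using Field by (auto simp: between_series_spans[OF spans meet])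
  qed
  have S: "between (?R \<union> ?S) (fst g) (snd g) = between ?S (fst g) (snd g)" if "g \<in> ?S" for g
  proof -
    have Field: "fst g \<in> Field ?S" "snd g \<in> Field ?S"
      using that by (cases g; auto simp: Field_def)+
    then have "fst g \<in> Field ?R \<Longrightarrow> fst g = m" using meet by blast
    moreover from this have "between ?R (fst g) m = {}"
      using between_same_empty[OF acyclic(1)] between_nonempty(1)[of ?R "fst g" m]
      by (metis FieldI1 DomainE RangeE)
    ultimately show ?thesis using Field by (auto simp: between_series_spans[OF spans meet])
  qed
  \<comment> \<open>A common arc would have to start at \<open>m\<close>, which is the sink of
    \<open>?R\<close>.\<close>
  have "?R \<inter> ?S = {}"
    using meet m by (auto simp: Field_def)
  then have disjoint: "between ?R a b \<inter> between ?S c d = {}" for a b c d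
    using between_subset[of ?R a b] between_subset[of ?S c d] by blast
  have "e \<in> ?R \<or> e \<in> ?S" "f \<in> ?R \<or> f \<in> ?S" using series.prems by auto
  then show ?case
    using R S series.IH disjoint by (elim disjE) (simp_all add: Int_commute)
qed

section \<open>From arc relations back to path subgraphs\<close>

lemma path_subgraph_st_dsp:
  assumes "st_dsp s t G"
  shows "path_subgraph G u v = arc_graph (between (parcs G) u v)"
proof -
  have "path_arcs G u v = between (parcs G) u v"
    using st_dsp_spans[OF assms] by (intro path_arcs_eq_between) (auto simp: spans_def wf_acyclic)
  then show ?thesis
    by (simp add: path_subgraph_def arc_graph_def Field_def Domain_fst Range_snd)
qed

lemma subgraph_arc_graph:
  assumes "R \<subseteq> S"
  shows "subgraph (with_proj (arc_graph R)) (with_proj (arc_graph S))"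
proof -
  have "wf_digraph (with_proj (arc_graph Q))" for Q :: "('a \<times> 'a) set"
    by unfold_locales (auto simp: Field_def)
  then show ?thesis
    using assms mono_Field[OF assms] by (simp add: subgraph_def compatible_def)
qed

theorem theorem5:
  fixes G :: "'a pair_pre_digraph"
  assumes "dsp G"
  shows "lsp G"
proof -
  obtain s t where G: "st_dsp s t G" using assms by (auto simp: dsp_def)
  note facts = st_dsp_spans[OF G]
  have "pair_digraph G"
  proof unfold_locales
    show "fst e \<in> pverts G" "snd e \<in> pverts G" if "e \<in> parcs G" for e
      using that facts(1) by (cases e; auto simp: Field_def)+
    show "finite (pverts G)" "finite (parcs G)"
      using facts by (auto simp: spans_def finite_Field)
    show "fst e \<noteq> snd e" if "e \<in> parcs G" for e
      using that facts(2) by (cases e) (auto simp: spans_def wf_not_refl)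
  qed
  then show ?thesis
    \<comment> \<open>Both properties now speak of \<open>between\<close>, and inclusions of arc
      sets lift to the subgraph relation.\<close>
    unfolding lsp_def arc_subgraph_def path_subgraph_st_dsp[OF G]
    using st_dsp_between[OF G] st_dsp_laminar[OF G] subgraph_arc_graph
    by (metis arc_graph_simps(2))
qed

end
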